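(* Let $(\alpha_n,\beta_n)_{n\in\mathbb{Z}}$ be a bilateral Bailey pair relative to $a$, and let $\rho,\sigma$ be complex parameters. Define for all $n\in\mathbb{Z}$ \[ \alpha'_n=\frac{(\rho,\sigma)_n(a/\rho\sigma)^n}{(a/\rho,a/\sigma)_n}(1-a)\left(\frac{q^n\alpha_n}{1-aq^{2n}}-\frac{q^{n-1}\alpha_{n-1}}{1-aq^{2n-2}}\right), \] \[ \beta'_n=\sum_{j\leq n}\frac{(\rho,\sigma)_j(a/\rho\sigma)_{n-j}(a/\rho\sigma)^j}{(q)_{n-j}(a/\rho,a/\sigma)_n}q^j\beta_j . \] Then, subject to convergence conditions on the sequences $\alpha_n,\beta_n$ making all the relevant infinite series absolutely convergent, $(\alpha'_n,\beta'_n)$ is a bilateral Bailey pair relative to $a/q$.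
   Context: Fix complex numbers $a,q$ with $|q|<1$ (parameters generic so that no denominator vanishes). For complex $x$, $(x)_\infty=\prod_{j\ge0}(1-xq^j)$ and for $k\in\mathbb{Z}$, $(x)_k=(x)_\infty/(xq^k)_\infty$ (so $1/(q)_k=0$ for $k<0$); $(x_1,\dots,x_m)_k=(x_1)_k\cdots(x_m)_k$. A bilateral Bailey pair relative to $c$ is a pair of sequences $(\alpha_n)_{n\in\mathbb{Z}},(\beta_n)_{n\in\mathbb{Z}}$ such that for every $n\in\mathbb{Z}$, $\beta_n=\sum_{j\le n}\frac{\alpha_j}{(q)_{n-j}(cq)_{n+j}}$ (the series being convergent). *)

theory Defs
  imports "HOL-Analysis.Analysis"
begin

definition qpoch_inf :: "complex \<Rightarrow> complex \<Rightarrow> complex" where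
  "qpoch_inf q x = (\<Prod>j. 1 - x * q ^ j)"

text \<open>
  If \<open>x\<close> is a positive power of \<open>q\<close>, then \<open>(x)\<^sub>k\<close> has a pole for all sufficiently small negative
  \<open>k\<close>. Since division by zero gives zero, both \<open>qpoch q x k\<close> and its reciprocal are then 0;
  for the reciprocal this is the value of \<open>(x q\<^sup>k)\<^sub>\<infinity> / (x)\<^sub>\<infinity>\<close>, the usual reading of \<open>1 / (x)\<^sub>k\<close>
  (in particular \<open>1 / (q)\<^sub>k = 0\<close> for \<open>k < 0\<close>).
\<close>
definition qpoch :: "complex \<Rightarrow> complex \<Rightarrow> int \<Rightarrow> complex" where
  "qpoch q x k = qpoch_inf q x / qpoch_inf q (x * q powi k)"

text \<open>The series of the terms \<open>f j\<close> over all integers \<open>j \<le> n\<close>, summed in the order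
  \<open>j = n, n - 1, n - 2, \<dots>\<close>; the convergence may be conditional.\<close>
definition sums_upto :: "(int \<Rightarrow> complex) \<Rightarrow> int \<Rightarrow> complex \<Rightarrow> bool" where
  "sums_upto f n s \<longleftrightarrow> (\<lambda>i. f (n - int i)) sums s"

definition sum_upto :: "(int \<Rightarrow> complex) \<Rightarrow> int \<Rightarrow> complex" where
  "sum_upto f n = (\<Sum>i. f (n - int i))"

definition bilateral_bailey_pair ::
    "complex \<Rightarrow> complex \<Rightarrow> (int \<Rightarrow> complex) \<Rightarrow> (int \<Rightarrow> complex) \<Rightarrow> bool" where
  "bilateral_bailey_pair q c \<alpha> \<beta> \<longleftrightarrow>
     (\<forall>n. sums_upto (\<lambda>j. \<alpha> j / (qpoch q q (n - j) * qpoch q (c * q) (n + j))) n (\<beta> n))"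

definition lattice_alpha ::
    "complex \<Rightarrow> complex \<Rightarrow> complex \<Rightarrow> complex \<Rightarrow> (int \<Rightarrow> complex) \<Rightarrow> int \<Rightarrow> complex" where
  "lattice_alpha q a \<rho> \<sigma> \<alpha> n =
     qpoch q \<rho> n * qpoch q \<sigma> n * (a / (\<rho> * \<sigma>)) powi n / (qpoch q (a / \<rho>) n * qpoch q (a / \<sigma>) n)
     * (1 - a)
     * (q powi n * \<alpha> n / (1 - a * q powi (2 * n))
        - q powi (n - 1) * \<alpha> (n - 1) / (1 - a * q powi (2 * n - 2)))"

definition lattice_weight ::
    "complex \<Rightarrow> complex \<Rightarrow> complex \<Rightarrow> complex \<Rightarrow> int \<Rightarrow> int \<Rightarrow> complex" where
  "lattice_weight q a \<rho> \<sigma> n j =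
     qpoch q \<rho> j * qpoch q \<sigma> j * qpoch q (a / (\<rho> * \<sigma>)) (n - j) * (a / (\<rho> * \<sigma>)) powi j
     / (qpoch q q (n - j) * (qpoch q (a / \<rho>) n * qpoch q (a / \<sigma>) n)) * q powi j"

definition lattice_beta ::
    "complex \<Rightarrow> complex \<Rightarrow> complex \<Rightarrow> complex \<Rightarrow> (int \<Rightarrow> complex) \<Rightarrow> int \<Rightarrow> complex" where
  "lattice_beta q a \<rho> \<sigma> \<beta> n = sum_upto (\<lambda>j. lattice_weight q a \<rho> \<sigma> n j * \<beta> j) n"

text \<open>Absolute convergence, for every \<open>n\<close>, of the double series over \<open>r \<le> j \<le> n\<close> obtained by inserting
  the series for \<open>\<beta> j\<close> into the one for \<open>lattice_beta\<close>. Absolute convergence of the single series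
  alone does not justify the lattice: the interchange of the two summations can then fail.\<close>
definition lattice_abs_convergent ::
    "complex \<Rightarrow> complex \<Rightarrow> complex \<Rightarrow> complex \<Rightarrow> (int \<Rightarrow> complex) \<Rightarrow> bool" where
  "lattice_abs_convergent q a \<rho> \<sigma> \<alpha> \<longleftrightarrow>
     (\<forall>n. (\<lambda>(j, r). norm (lattice_weight q a \<rho> \<sigma> n j
              * (\<alpha> r / (qpoch q q (j - r) * qpoch q (a * q) (j + r)))))
          summable_on (SIGMA j:{..n}. {..j}))"

end

theory Submission
  imports Defs
begin

text \<open>
  Inserting the series for \<open>\<beta>\<^sub>j\<close> into the one for \<open>\<beta>'\<^sub>n\<close> and interchanging the summations, the coefficient
  of \<open>\<alpha>\<^sub>r\<close> becomes a finite sum over \<open>r \<le> j \<le> n\<close>. This sum is contiguous to the \<open>q\<close>-Pfaff--Saalschuetz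
  sum, and its value is a difference of two consecutive coefficients of the series for \<open>\<alpha>'\<close>. Summation by
  parts then yields the defining series of the new pair, up to a boundary term at \<open>-\<infinity>\<close>. That term
  vanishes because it is negligible against the terms \<open>j = r\<close> of the double series.
\<close>

section \<open>Finite q-products and the q-Pfaff--Saalschuetz sum\<close>

definition qfin :: "complex \<Rightarrow> complex \<Rightarrow> nat \<Rightarrow> complex" where
  "qfin q x n = (\<Prod>k<n. 1 - x * q ^ k)"

lemma qfin_0 [simp]: "qfin q x 0 = 1"
  by (simp add: qfin_def)

lemma qfin_Suc: "qfin q x (Suc n) = qfin q x n * (1 - x * q ^ n)"
  by (simp add: qfin_def)

lemma qfin_Suc_left: "qfin q x (Suc n) = (1 - x) * qfin q (x * q) n"
  by (simp add: qfin_def prod.lessThan_Suc_shift mult.assoc del: prod.lessThan_Suc)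

lemma qfin_q_nonzero:
  assumes "\<And>k. q ^ Suc k \<noteq> 1"
  shows "qfin q q n \<noteq> 0"
  using assms by (auto simp: qfin_def)

text \<open>Up to the factor \<open>(e)_N (b)_N / (q)_N\<close>, this is the summand of the
  terminating \<open>3phi2\<close> series with upper parameters \<open>x, y, q^(-N)\<close>, lower
  parameters \<open>b, q^(1-N)/e\<close> and argument \<open>q\<close>, which is balanced when
  \<open>b = e * x * y\<close>. In this form the only denominators are products
  \<open>qfin q q\<close>.\<close>

definition saalschutz_term :: "complex \<Rightarrow> complex \<Rightarrow> complex \<Rightarrow> complex \<Rightarrow> complex \<Rightarrow> nat \<Rightarrow> nat \<Rightarrow> complex" where
  "saalschutz_term q e x y b N i = qfin q x i * qfin q y i * e ^ i / qfin q q i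
     * (qfin q e (N - i) / qfin q q (N - i)) * qfin q (b * q ^ i) (N - i)"

text \<open>Creative telescoping in \<open>N\<close>: the right-hand side is the certificate, whose
  increment in \<open>k\<close> is the summand at \<open>i = k\<close>. Partial sums are taken so
  that induction on \<open>k\<close> applies.\<close>

lemma saalschutz_telescope:
  fixes q e x y :: complex
  assumes q: "\<And>k. q ^ Suc k \<noteq> 1" and b: "b = e * x * y"
  shows "k \<le> N \<Longrightarrow>
    (\<Sum>i\<le>k. (1 - q ^ Suc N) * saalschutz_term q e x y b (Suc N) i
          - (1 - e * x * q ^ N) * (1 - e * y * q ^ N) * saalschutz_term q e x y b N i)
    = - (q ^ (N - k) * qfin q x (Suc k) * qfin q y (Suc k) * e ^ Suc k / qfin q q k
         * (qfin q e (N - k) / qfin q q (N - k)) * qfin q (b * q ^ k) (N - k))"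
proof (induction k)
  case 0
  define p where "p = q ^ N"
  have nz: "1 - q * p \<noteq> 0" "qfin q q N \<noteq> 0" using q[of N] qfin_q_nonzero[OF q] by (auto simp: p_def)
  have "(1 - q * p) * (qfin q e N * (1 - e * p) / (qfin q q N * (1 - q * p)) * (qfin q b N * (1 - b * p)))
     - (1 - e * x * p) * (1 - e * y * p) * (qfin q e N / qfin q q N * qfin q b N)
     = qfin q e N / qfin q q N * qfin q b N * ((1 - e * p) * (1 - b * p) - (1 - e * x * p) * (1 - e * y * p))"
    using nz by (simp add: field_simps)
  also have "(1 - e * p) * (1 - b * p) - (1 - e * x * p) * (1 - e * y * p) = - (p * (1 - x) * (1 - y) * e)"
    unfolding b by algebra
  finally show ?case
    by (simp add: saalschutz_term_def qfin_Suc p_def[symmetric] ac_simps)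
next
  case (Suc k)
  \<comment> \<open>Replacing \<open>N\<close> by \<open>Suc (k + M)\<close> removes truncated
    subtraction; in terms of \<open>z\<close> and \<open>p\<close> all remaining powers of
    \<open>q\<close> are monomials.\<close>
  define M where "M = N - Suc k"
  have N: "N = Suc (k + M)" using Suc.prems by (simp add: M_def)
  define z p where "z = q ^ k" and "p = q ^ M"
  define C where "C = qfin q x (Suc k) * qfin q y (Suc k) * e ^ Suc k / qfin q q k
      * (qfin q e M / qfin q q M) * qfin q (b * q ^ Suc k) M"
  have nz: "1 - q * p \<noteq> 0" "1 - q * z \<noteq> 0" "qfin q q M \<noteq> 0" "qfin q q k \<noteq> 0"
    using q[of M] q[of k] qfin_q_nonzero[OF q] by (auto simp: p_def z_def)
  have W: "q ^ N = q * z * p" by (simp add: N z_def p_def power_add)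
  have s1: "saalschutz_term q e x y b (Suc N) (Suc k) = C / (1 - q * z) * ((1 - e * p) / (1 - q * p)) * (1 - b * q * z * p)"
    using nz by (simp add: saalschutz_term_def N C_def qfin_Suc z_def[symmetric] p_def[symmetric] ac_simps Suc_diff_le)
  have s2: "saalschutz_term q e x y b N (Suc k) = C / (1 - q * z)"
    using nz by (simp add: saalschutz_term_def N C_def qfin_Suc z_def[symmetric] p_def[symmetric])
  have s3: "q ^ (N - k) * qfin q x (Suc k) * qfin q y (Suc k) * e ^ Suc k / qfin q q k
         * (qfin q e (N - k) / qfin q q (N - k)) * qfin q (b * q ^ k) (N - k)
      = q * p * C * ((1 - e * p) / (1 - q * p)) * (1 - b * z)"
  proof -
    have "N - k = Suc M" by (simp add: N)
    moreover have "qfin q (b * q ^ k) (Suc M) = (1 - b * z) * qfin q (b * q ^ Suc k) M"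
      by (simp add: qfin_Suc_left z_def ac_simps)
    moreover have "qfin q e (Suc M) / qfin q q (Suc M) = qfin q e M / qfin q q M * ((1 - e * p) / (1 - q * p))"
      by (simp add: qfin_Suc p_def)
    ultimately show ?thesis unfolding C_def by (simp add: p_def ac_simps)
  qed
  have s4: "q ^ (N - Suc k) * qfin q x (Suc (Suc k)) * qfin q y (Suc (Suc k)) * e ^ Suc (Suc k) / qfin q q (Suc k)
         * (qfin q e (N - Suc k) / qfin q q (N - Suc k)) * qfin q (b * q ^ Suc k) (N - Suc k)
     = p * (1 - x * q * z) * (1 - y * q * z) * e * C / (1 - q * z)"
  proof -
    have "qfin q x (Suc (Suc k)) = qfin q x (Suc k) * (1 - x * q * z)"
      "qfin q y (Suc (Suc k)) = qfin q y (Suc k) * (1 - y * q * z)"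
      "qfin q q (Suc k) = qfin q q k * (1 - q * z)"
      by (simp_all add: qfin_Suc z_def)
    then show ?thesis unfolding C_def M_def[symmetric] p_def by (simp add: ac_simps)
  qed
  \<comment> \<open>Once the common factor \<open>C / ((1 - q * z) * (1 - q * p))\<close> is taken
    out, the induction step is this polynomial identity.\<close>
  have key: "(1 - q * q * z * p) * (1 - e * p) * (1 - b * q * z * p)
      - (1 - e * x * (q * z * p)) * (1 - e * y * (q * z * p)) * (1 - q * p)
      - q * p * (1 - e * p) * (1 - b * z) * (1 - q * z)
      = - (p * (1 - x * q * z) * (1 - y * q * z) * e * (1 - q * p))"
    unfolding b by algebra
  have "(1 - q * (q * z * p)) * (C / (1 - q * z) * ((1 - e * p) / (1 - q * p)) * (1 - b * q * z * p))
      - (1 - e * x * (q * z * p)) * (1 - e * y * (q * z * p)) * (C / (1 - q * z))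
      - q * p * C * ((1 - e * p) / (1 - q * p)) * (1 - b * z)
     = C / ((1 - q * z) * (1 - q * p)) * ((1 - q * q * z * p) * (1 - e * p) * (1 - b * q * z * p)
      - (1 - e * x * (q * z * p)) * (1 - e * y * (q * z * p)) * (1 - q * p)
      - q * p * (1 - e * p) * (1 - b * z) * (1 - q * z))"
    using nz(1,2) by (simp add: divide_simps) algebra
  also have "\<dots> = - (p * (1 - x * q * z) * (1 - y * q * z) * e * C / (1 - q * z))"
    unfolding key using nz(1,2) by (simp add: divide_simps)
  finally have fin: "(1 - q * (q * z * p)) * (C / (1 - q * z) * ((1 - e * p) / (1 - q * p)) * (1 - b * q * z * p))
      - (1 - e * x * (q * z * p)) * (1 - e * y * (q * z * p)) * (C / (1 - q * z))
      - q * p * C * ((1 - e * p) / (1 - q * p)) * (1 - b * z)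
      = - (p * (1 - x * q * z) * (1 - y * q * z) * e * C / (1 - q * z))" .
  have IH: "(\<Sum>i\<le>k. (1 - q ^ Suc N) * saalschutz_term q e x y b (Suc N) i
          - (1 - e * x * q ^ N) * (1 - e * y * q ^ N) * saalschutz_term q e x y b N i)
     = - (q * p * C * ((1 - e * p) / (1 - q * p)) * (1 - b * z))"
    unfolding s3[symmetric] by (rule Suc.IH) (use Suc.prems in simp)
  have "(\<Sum>i\<le>Suc k. (1 - q ^ Suc N) * saalschutz_term q e x y b (Suc N) i
          - (1 - e * x * q ^ N) * (1 - e * y * q ^ N) * saalschutz_term q e x y b N i)
     = - (q * p * C * ((1 - e * p) / (1 - q * p)) * (1 - b * z))
       + ((1 - q ^ Suc N) * saalschutz_term q e x y b (Suc N) (Suc k)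
          - (1 - e * x * q ^ N) * (1 - e * y * q ^ N) * saalschutz_term q e x y b N (Suc k))"
    by (simp only: sum.atMost_Suc IH)
  also have "\<dots> = - (p * (1 - x * q * z) * (1 - y * q * z) * e * C / (1 - q * z))"
    unfolding s1 s2 power_Suc[of q N] W by (subst fin[symmetric], simp only: add.commute[of "- _"] diff_conv_add_uminus)
  finally show ?case unfolding s4 .
qed

text \<open>At \<open>k = N\<close> the telescoped sum is exactly minus the additional top term
  \<open>i = Suc N\<close>. The two cancel, leaving a first-order recurrence in \<open>N\<close>
  that the product on the right satisfies.\<close>

lemma q_pfaff_saalschutz:
  fixes q e x y :: complex
  assumes q: "\<And>k. q ^ Suc k \<noteq> 1" and b: "b = e * x * y"
  shows "(\<Sum>i\<le>N. saalschutz_term q e x y b N i) = qfin q (e * x) N * qfin q (e * y) N / qfin q q N"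
proof (induction N)
  case 0
  show ?case by (simp add: saalschutz_term_def)
next
  case (Suc N)
  have nz: "1 - q * q ^ N \<noteq> 0" "qfin q q N \<noteq> 0" using q[of N] qfin_q_nonzero[OF q] by auto
  have "(1 - q ^ Suc N) * saalschutz_term q e x y b (Suc N) (Suc N)
      = qfin q x (Suc N) * qfin q y (Suc N) * e ^ Suc N / qfin q q N"
    using nz by (simp add: saalschutz_term_def qfin_Suc)
  moreover have "(1 - q ^ Suc N) * (\<Sum>i\<le>N. saalschutz_term q e x y b (Suc N) i)
        - (1 - e * x * q ^ N) * (1 - e * y * q ^ N) * (\<Sum>i\<le>N. saalschutz_term q e x y b N i)
        = - (qfin q x (Suc N) * qfin q y (Suc N) * e ^ Suc N / qfin q q N)"
    using saalschutz_telescope[OF q b, of N N] by (simp add: sum_subtractf sum_distrib_left)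
  ultimately have "(1 - q ^ Suc N) * (\<Sum>i\<le>Suc N. saalschutz_term q e x y b (Suc N) i)
        = (1 - e * x * q ^ N) * (1 - e * y * q ^ N) * (\<Sum>i\<le>N. saalschutz_term q e x y b N i)"
    unfolding sum.atMost_Suc distrib_left by (simp only: diff_eq_eq) simp
  then show ?case unfolding Suc using nz by (simp add: qfin_Suc field_simps)
qed

text \<open>The identity \<open>(c)\<^sub>M/(q)\<^sub>M = (cq)\<^sub>M/(q)\<^sub>M - c (cq)\<^sub>M\<^sub>-\<^sub>1/(q)\<^sub>M\<^sub>-\<^sub>1\<close> reduces this sum to two
  instances of the \<open>q\<close>-Pfaff--Saalschuetz sum.\<close>
lemma contiguous_saalschutz:
  fixes q c x y :: complex
  assumes q: "\<And>k. q ^ Suc k \<noteq> 1" and A: "A = c * x * y"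
  shows "(1 - A) * (\<Sum>i\<le>N. qfin q x i * qfin q y i * (c * q) ^ i / qfin q q i
            * (qfin q c (N - i) / qfin q q (N - i)) * qfin q (A * q * q ^ i) (N - i))
    = qfin q (c * x) N * qfin q (c * y) N * (1 - A * q ^ N) / qfin q q N
      - (if N = 0 then 0 else c * (1 - x) * (1 - y) * qfin q (c * x * q) (N - 1) * qfin q (c * y * q) (N - 1)
           / qfin q q (N - 1))"
proof (cases N)
  case 0
  then show ?thesis by simp
next
  case (Suc K)
  define s where "s N i = saalschutz_term q (c * q) x y (A * q) N i" for N i
  define T where "T i = qfin q x i * qfin q y i * (c * q) ^ i / qfin q q i
            * (qfin q c (N - i) / qfin q q (N - i)) * qfin q (A * q * q ^ i) (N - i)" for i
  have Aq: "A * q = c * q * x * y" by (simp add: A)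
  have Ti: "T i = s N i - c * (1 - A * q * q ^ K) * s K i" if "i \<le> K" for i
  proof -
    define M where "M = K - i"
    have K: "K = M + i" using that by (simp add: M_def)
    have nz: "1 - q * q ^ M \<noteq> 0" "qfin q q M \<noteq> 0" using q[of M] qfin_q_nonzero[OF q] by auto
    have c1: "qfin q c (Suc M) / qfin q q (Suc M)
        = qfin q (c * q) (Suc M) / qfin q q (Suc M) - c * (qfin q (c * q) M / qfin q q M)"
      unfolding qfin_Suc_left[of q c] qfin_Suc[of q "c * q"] qfin_Suc[of q q] using nz
      by (simp add: field_simps)
    have c2: "qfin q (A * q * q ^ i) (Suc M) = qfin q (A * q * q ^ i) M * (1 - A * q * q ^ K)"
      by (simp add: qfin_Suc K power_add ac_simps)
    have NM: "N - i = Suc M" "K - i = M" by (simp_all add: Suc K)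
    show ?thesis unfolding T_def s_def saalschutz_term_def NM c1 c2
      by (simp only: algebra_simps)
  qed
  \<comment> \<open>At \<open>i = N\<close> the product of length \<open>N - i\<close> is empty, so
    this term is not split: it belongs to the longer sum only.\<close>
  have TN: "T N = s N N" by (simp add: T_def s_def saalschutz_term_def)
  have "sum T {..N} = (\<Sum>i\<le>K. s N i - c * (1 - A * q * q ^ K) * s K i) + s N N"
    using Ti TN by (simp add: Suc)
  also have "\<dots> = sum (s N) {..N} - c * (1 - A * q * q ^ K) * sum (s K) {..K}"
    by (simp add: Suc sum_subtractf sum_distrib_left)
  also have "sum (s N) {..N} = qfin q (c * q * x) N * qfin q (c * q * y) N / qfin q q N"
    unfolding s_def by (rule q_pfaff_saalschutz[OF q Aq])
  also have "sum (s K) {..K} = qfin q (c * q * x) K * qfin q (c * q * y) K / qfin q q K"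
    unfolding s_def by (rule q_pfaff_saalschutz[OF q Aq])
  finally have sumT: "sum T {..N} = qfin q (c * q * x) N * qfin q (c * q * y) N / qfin q q N
      - c * (1 - A * q * q ^ K) * (qfin q (c * q * x) K * qfin q (c * q * y) K / qfin q q K)" .
  define p X Y Z where "p = q ^ K" and "X = qfin q (c * x * q) K" and "Y = qfin q (c * y * q) K"
    and "Z = qfin q q K"
  have XY: "qfin q (c * q * x) K = X" "qfin q (c * q * y) K = Y"
    by (simp_all add: X_def Y_def ac_simps)
  have nz: "1 - q * p \<noteq> 0" "Z \<noteq> 0" using q[of K] qfin_q_nonzero[OF q] by (auto simp: p_def Z_def)
  have l: "qfin q (c * q * x) N = X * (1 - c * q * x * p)" "qfin q (c * q * y) N = Y * (1 - c * q * y * p)"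
    "qfin q q N = Z * (1 - q * p)" "qfin q (c * x) N = (1 - c * x) * X" "qfin q (c * y) N = (1 - c * y) * Y"
    "q ^ N = q * p"
    unfolding Suc qfin_Suc_left[of q "c * x"] qfin_Suc_left[of q "c * y"]
    by (simp_all add: qfin_Suc XY p_def Z_def X_def Y_def)
  \<comment> \<open>The two closed forms share the factor \<open>X * Y / (Z * (1 - q * p))\<close>;
    what remains is polynomial in \<open>p\<close>, \<open>q\<close>, \<open>c\<close>,
    \<open>x\<close>, \<open>y\<close>.\<close>
  have key: "(1 - A) * ((1 - c * q * x * p) * (1 - c * q * y * p) - c * (1 - A * q * p) * (1 - q * p))
     = (1 - c * x) * (1 - c * y) * (1 - A * (q * p)) - c * (1 - x) * (1 - y) * (1 - q * p)"
    unfolding A by algebra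
  have "(1 - A) * sum T {..N} = X * Y / (Z * (1 - q * p)) *
     ((1 - A) * ((1 - c * q * x * p) * (1 - c * q * y * p) - c * (1 - A * q * p) * (1 - q * p)))"
    unfolding sumT l XY Z_def[symmetric] p_def[symmetric] using nz
    by (simp add: divide_simps) algebra
  also have "\<dots> = (1 - c * x) * X * ((1 - c * y) * Y) * (1 - A * (q * p)) / (Z * (1 - q * p))
     - c * (1 - x) * (1 - y) * X * Y / Z"
    unfolding key using nz by (simp add: divide_simps) algebra
  finally show ?thesis
    unfolding T_def l using Suc by (simp add: X_def Y_def Z_def)
qed

section \<open>Infinite q-products and shifted factorials with integer index\<close>

lemma convergent_prod_qpoch:
  assumes "norm (q :: complex) < 1"
  shows "convergent_prod (\<lambda>j. 1 - x * q ^ j)"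
proof (rule abs_convergent_prod_imp_convergent_prod, rule summable_imp_abs_convergent_prod)
  show "summable (\<lambda>i. norm (1 - x * q ^ i - 1))"
    using assms by (simp add: norm_mult norm_power summable_mult summable_geometric)
qed

lemma qfin_tendsto:
  assumes "norm (q :: complex) < 1"
  shows "qfin q x \<longlonglongrightarrow> qpoch_inf q x"
  using convergent_prod_LIMSEQ[OF convergent_prod_qpoch[OF assms, of x]]
  unfolding qfin_def[abs_def] qpoch_inf_def by (simp add: LIMSEQ_lessThan_iff_atMost)

lemma qpoch_inf_step:
  assumes "norm (q :: complex) < 1"
  shows "qpoch_inf q x = (1 - x) * qpoch_inf q (x * q)"
proof (rule LIMSEQ_unique)
  show "(\<lambda>n. qfin q x (Suc n)) \<longlonglongrightarrow> qpoch_inf q x"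
    using qfin_tendsto[OF assms] by (rule LIMSEQ_Suc)
  show "(\<lambda>n. qfin q x (Suc n)) \<longlonglongrightarrow> (1 - x) * qpoch_inf q (x * q)"
    unfolding qfin_Suc_left by (intro tendsto_mult tendsto_const qfin_tendsto assms)
qed

lemma power_Suc_neq_1:
  assumes "norm (q :: complex) < 1"
  shows "q ^ Suc k \<noteq> 1"
proof
  assume "q ^ Suc k = 1"
  then have "norm q ^ Suc k = 1" by (metis norm_one norm_power)
  moreover have "norm q ^ Suc k < 1 ^ Suc k" using assms by (intro power_strict_mono) auto
  ultimately show False by simp
qed

lemma qpoch_inf_q_nonzero:
  assumes "norm (q :: complex) < 1"
  shows "qpoch_inf q q \<noteq> 0"
  unfolding qpoch_inf_def
  using prodinf_nonzero[OF convergent_prod_qpoch[OF assms, of q]] power_Suc_neq_1[OF assms] by simp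

text \<open>The reciprocal \<open>1 / (x)\<^sub>k\<close>; unlike \<open>qpoch\<close>, it has the right value (namely 0) where \<open>(x)\<^sub>k\<close> has a pole,
  so its recurrences need no side conditions.\<close>
definition rpoch :: "complex \<Rightarrow> complex \<Rightarrow> int \<Rightarrow> complex" where
  "rpoch q x k = qpoch_inf q (x * q powi k) / qpoch_inf q x"

lemma divide_qpoch: "z / qpoch q x k = z * rpoch q x k"
  by (simp add: qpoch_def rpoch_def)

lemma divide_mult_qpoch: "z / (qpoch q x k * w) = z * rpoch q x k / w"
  by (simp add: qpoch_def rpoch_def)

lemma rpoch_step:
  assumes "norm q < 1" "q \<noteq> 0"
  shows "rpoch q x k = (1 - x * q powi k) * rpoch q x (k + 1)"
  using qpoch_inf_step[OF assms(1), of "x * q powi k"] assms(2)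
  by (simp add: rpoch_def power_int_add mult.assoc)

lemma rpoch_shift:
  assumes "norm q < 1" "q \<noteq> 0"
  shows "rpoch q x k = qfin q (x * q powi k) m * rpoch q x (k + int m)"
proof (induction m)
  case (Suc m)
  then show ?case
    using rpoch_step[OF assms, of x "k + int m"] assms(2)
    by (simp add: qfin_Suc power_int_add ac_simps)
qed simp

lemma rpoch_0: "qpoch_inf q x \<noteq> 0 \<Longrightarrow> rpoch q x 0 = 1"
  by (simp add: rpoch_def)

lemma rpoch_of_nat:
  assumes "norm q < 1" "q \<noteq> 0" "qpoch_inf q x \<noteq> 0"
  shows "rpoch q x (int m) = 1 / qfin q x m" and "qfin q x m \<noteq> 0"
proof -
  have "1 = qfin q x m * rpoch q x (int m)"
    using rpoch_shift[OF assms(1,2), of x 0 m] assms(3) by (simp add: rpoch_0)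
  then show "rpoch q x (int m) = 1 / qfin q x m" "qfin q x m \<noteq> 0"
    by (auto simp: eq_divide_eq mult.commute)
qed

lemma qpoch_eq_inverse_rpoch: "qpoch q x k = 1 / rpoch q x k"
  by (simp add: qpoch_def rpoch_def)

lemma qpoch_of_nat:
  assumes "norm q < 1" "q \<noteq> 0" "qpoch_inf q x \<noteq> 0"
  shows "qpoch q x (int m) = qfin q x m"
  by (simp add: qpoch_eq_inverse_rpoch rpoch_of_nat[OF assms])

text \<open>Inverting \<open>rpoch_shift\<close> requires both reciprocals to be nonzero, hence the
  condition at every integer shift.\<close>

lemma qpoch_shift:
  assumes "norm q < 1" "q \<noteq> 0" "\<And>n. qpoch_inf q (x * q powi n) \<noteq> 0"
  shows "qpoch q x (k + int m) = qpoch q x k * qfin q (x * q powi k) m"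
proof -
  have "rpoch q x k \<noteq> 0" "rpoch q x (k + int m) \<noteq> 0"
    using assms(3) assms(3)[of 0] by (simp_all add: rpoch_def)
  then show ?thesis
    using rpoch_shift[OF assms(1,2), of x k m]
    by (simp add: qpoch_eq_inverse_rpoch)
qed

text \<open>The infinite product then starts at \<open>q * q powi (-1) = 1\<close>, so its first
  factor is zero. This cuts off the coefficients of the new pair just above
  \<open>r = n\<close>.\<close>

lemma rpoch_q_minus_1:
  assumes "norm q < 1" "q \<noteq> 0"
  shows "rpoch q q (-1) = 0"
  using qpoch_inf_step[OF assms(1), of 1] assms(2) by (simp add: rpoch_def power_int_minus)

section \<open>Series over the integers up to \<open>n\<close>\<close>

lemma has_sum_atMost_imp_sums_upto:
  assumes "(f has_sum s) {..n}"
  shows "sums_upto f n s"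
proof -
  have "bij_betw (\<lambda>i. n - int i) UNIV {..n}"
    by (rule bij_betwI[where g = "\<lambda>j. nat (n - j)"]) auto
  then have "((\<lambda>i. f (n - int i)) has_sum s) UNIV"
    using assms by (subst has_sum_reindex_bij_betw)
  then show ?thesis
    unfolding sums_upto_def by (rule has_sum_imp_sums)
qed

lemma sum_upto_eqI: "sums_upto f n s \<Longrightarrow> sum_upto f n = s"
  by (simp add: sums_upto_def sum_upto_def sums_iff)

text \<open>Absolute summability over the triangle \<open>r \<le> j \<le> n\<close> gives one value
  \<open>S\<close> that can be computed by rows or by columns.\<close>

lemma triangular_series_swap:
  fixes f :: "int \<Rightarrow> int \<Rightarrow> complex"
  assumes f: "(\<lambda>(j, r). norm (f j r)) summable_on (SIGMA j:{..n}. {..j})"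
    and g: "\<And>j. j \<le> n \<Longrightarrow> sums_upto (f j) j (g j)"
  shows "sums_upto (\<lambda>r. \<Sum>j=r..n. f j r) n (sum_upto g n)"
proof -
  let ?F = "\<lambda>(j, r). f j r"
  have "?F summable_on (SIGMA j:{..n}. {..j})"
    by (rule abs_summable_summable) (use f in \<open>simp add: case_prod_beta'\<close>)
  then obtain S where S: "(?F has_sum S) (SIGMA j:{..n}. {..j})"
    by (auto simp: summable_on_def)
  \<comment> \<open>The hypothesis on \<open>g\<close> is only ordered convergence. Unordered
    summability of a row is inherited from the triangle, and uniqueness of limits identifies its
    value with \<open>g j\<close>.\<close>
  have row: "(f j has_sum g j) {..j}" if "j \<le> n" for j
  proof -
    have "f j summable_on {..j}"
      by (rule summable_on_SigmaD1[of f "{..n}"]) (use S that in \<open>auto simp: summable_on_def\<close>)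
    then have "(f j has_sum infsum (f j) {..j}) {..j}"
      by (rule has_sum_infsum)
    moreover from has_sum_atMost_imp_sums_upto[OF this] g[OF that] have "infsum (f j) {..j} = g j"
      unfolding sums_upto_def by (rule sums_unique2)
    ultimately show ?thesis by simp
  qed
  have "(g has_sum S) {..n}"
    by (rule has_sum_SigmaD[OF S]) (use row in auto)
  then have sg: "sum_upto g n = S"
    by (intro sum_upto_eqI has_sum_atMost_imp_sums_upto)
  \<comment> \<open>With the coordinates exchanged, every inner sum runs over the finite interval
    \<open>{r..n}\<close>.\<close>
  have "((\<lambda>(r, j). f j r) has_sum S) (SIGMA r:{..n}. {r..n})"
    using S by (rule has_sum_reindex_bij_witness[where i = prod.swap and j = prod.swap, THEN iffD2, rotated -1]) auto
  then have "((\<lambda>r. \<Sum>j=r..n. f j r) has_sum S) {..n}"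
    by (rule has_sum_SigmaD) (simp add: has_sum_finite)
  then show ?thesis
    unfolding sg by (rule has_sum_atMost_imp_sums_upto)
qed

text \<open>The diagonal is a subfamily of a summable family. This extracts from the convergence
  hypothesis the decay of \<open>\<alpha>\<close> that the boundary term requires.\<close>

lemma triangular_series_diagonal_tendsto_0:
  fixes f :: "int \<Rightarrow> int \<Rightarrow> complex"
  assumes "(\<lambda>(j, r). norm (f j r)) summable_on (SIGMA j:{..n}. {..j})"
  shows "(\<lambda>m. f (n - int m) (n - int m)) \<longlonglongrightarrow> 0"
proof -
  have "(\<lambda>(j, r). norm (f j r)) summable_on ((\<lambda>m. (n - int m, n - int m)) ` UNIV)"
    by (rule summable_on_subset_banach[OF assms]) auto
  then have "(\<lambda>m. norm (f (n - int m) (n - int m))) summable_on UNIV"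
    by (subst (asm) summable_on_reindex) (auto simp: inj_on_def o_def)
  then show ?thesis
    by (rule tendsto_norm_zero_cancel[OF summable_LIMSEQ_zero[OF summable_on_imp_summable]])
qed

text \<open>The ratio test, with the ratio in product form so that \<open>Y k\<close> may
  vanish.\<close>

lemma tendsto_0_if_ratio_tendsto_0:
  fixes Y R :: "nat \<Rightarrow> complex"
  assumes "eventually (\<lambda>k. Y (Suc k) = Y k * R k) sequentially" "R \<longlonglongrightarrow> 0"
  shows "Y \<longlonglongrightarrow> 0"
proof -
  have "eventually (\<lambda>k. norm (R k) < 1/2) sequentially"
    using tendstoD[OF assms(2), of "1/2"] by (simp add: dist_norm)
  with assms(1) have "eventually (\<lambda>k. norm (Y (Suc k)) \<le> 1/2 * norm (Y k)) sequentially"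
  proof eventually_elim
    case (elim k)
    then show ?case
      using mult_right_mono[of "norm (R k)" "1/2" "norm (Y k)"] by (simp add: norm_mult mult.commute)
  qed
  then obtain N where "\<And>k. k \<ge> N \<Longrightarrow> norm (Y (Suc k)) \<le> 1/2 * norm (Y k)"
    by (auto simp: eventually_sequentially)
  then have "summable Y"
    by (intro summable_ratio_test[of "1/2"]) auto
  then show ?thesis by (rule summable_LIMSEQ_zero)
qed

section \<open>The finite inner sum and the coefficients of the new pair\<close>

text \<open>\<open>\<rho>\<close> and \<open>\<sigma>\<close> are restricted at all integers because
  \<open>(\<rho>)_j\<close> and \<open>(\<sigma>)_j\<close> stand in numerators with arbitrarily
  negative \<open>j\<close>. For \<open>a / (\<rho> * \<sigma>)\<close> the index is
  \<open>n - j\<close>, which is nonnegative.\<close>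

locale bailey_lattice =
  fixes a q \<rho> \<sigma> :: complex
  assumes norm_q: "norm q < 1" and q_nz: "q \<noteq> 0"
    and a_nz: "a \<noteq> 0" and \<rho>_nz: "\<rho> \<noteq> 0" and \<sigma>_nz: "\<sigma> \<noteq> 0"
    and inf_a: "qpoch_inf q a \<noteq> 0"
    and aq_nz: "\<And>n::int. 1 - a * q powi (2 * n) \<noteq> 0"
    and inf_\<rho>: "\<And>n::int. qpoch_inf q (\<rho> * q powi n) \<noteq> 0"
    and inf_\<sigma>: "\<And>n::int. qpoch_inf q (\<sigma> * q powi n) \<noteq> 0"
    and inf_c: "qpoch_inf q (a / (\<rho> * \<sigma>)) \<noteq> 0"
begin

abbreviation "c \<equiv> a / (\<rho> * \<sigma>)"

text \<open>The factor with \<open>\<alpha>'\<^sub>r / ((q)\<^sub>n\<^sub>-\<^sub>r (a)\<^sub>n\<^sub>+\<^sub>r) = alpha_coeff n r \<cdot> (1 - a) (g\<^sub>r - g\<^sub>r\<^sub>-\<^sub>1)\<close>, where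
  \<open>g\<^sub>r = q\<^sup>r \<alpha>\<^sub>r / (1 - a q\<^sup>2\<^sup>r)\<close>.\<close>
definition alpha_coeff :: "int \<Rightarrow> int \<Rightarrow> complex" where
  "alpha_coeff n r = qpoch q \<rho> r * qpoch q \<sigma> r * c powi r * rpoch q (a / \<rho>) r * rpoch q (a / \<sigma>) r
     * rpoch q q (n - r) * rpoch q a (n + r)"

lemmas q_pow = power_Suc_neq_1[OF norm_q]
lemmas shift = rpoch_shift[OF norm_q q_nz]
lemmas q_nat = rpoch_of_nat[OF norm_q q_nz qpoch_inf_q_nonzero[OF norm_q]]

lemma q_powi_double: "q powi (2 * k) = (q powi k)\<^sup>2"
  using power_int_add[of q k k] q_nz by (simp add: power2_eq_square)

lemma weight_eq:
  "lattice_weight q a \<rho> \<sigma> n j = qpoch q \<rho> j * qpoch q \<sigma> j * qpoch q c (n - j) * (c * q) powi j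
     * rpoch q q (n - j) * rpoch q (a / \<rho>) n * rpoch q (a / \<sigma>) n"
  by (simp add: lattice_weight_def qpoch_eq_inverse_rpoch[of q q] qpoch_eq_inverse_rpoch[of q "a / \<rho>"]
      qpoch_eq_inverse_rpoch[of q "a / \<sigma>"] power_int_mult_distrib power_int_divide_distrib ac_simps)

text \<open>A pair relative to \<open>a\<close> involves \<open>(a q)_k\<close>, one relative to
  \<open>a / q\<close> involves \<open>(a)_k\<close>; the factor \<open>1 - a\<close> in
  \<open>lattice_alpha\<close> pays for the conversion.\<close>

lemma rpoch_a:
  "(1 - a) * rpoch q a (k + 1) = rpoch q (a * q) k"
proof -
  have "qpoch_inf q a = (1 - a) * qpoch_inf q (a * q)"
    by (rule qpoch_inf_step[OF norm_q])
  then show ?thesis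
    using inf_a q_nz by (auto simp: rpoch_def power_int_add ac_simps)
qed

text \<open>Every reciprocal is moved to the endpoint \<open>n\<close>, so that the coefficient
  shares its infinite products with \<open>lattice_weight q a \<rho> \<sigma> n\<close>. Both the
  kernel and the boundary term are compared with it in this form.\<close>

lemma alpha_coeff_Suc:
  fixes k :: nat
  assumes r: "n = r + 1 + int k"
  shows "(1 - a) * alpha_coeff n (r + 1) = qpoch q \<rho> r * qpoch q \<sigma> r * c powi r * rpoch q (a / \<rho>) n * rpoch q (a / \<sigma>) n
     * rpoch q (a * q) (n + r) * (c * (1 - \<rho> * q powi r) * (1 - \<sigma> * q powi r)
     * qfin q (a / \<rho> * q powi (r + 1)) k * qfin q (a / \<sigma> * q powi (r + 1)) k / qfin q q k)"
proof -
  have "qpoch q \<rho> (r + 1) = qpoch q \<rho> r * (1 - \<rho> * q powi r)"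
    using qpoch_shift[OF norm_q q_nz inf_\<rho>, of r 1] by (simp add: qfin_Suc)
  moreover have "qpoch q \<sigma> (r + 1) = qpoch q \<sigma> r * (1 - \<sigma> * q powi r)"
    using qpoch_shift[OF norm_q q_nz inf_\<sigma>, of r 1] by (simp add: qfin_Suc)
  moreover have "c powi (r + 1) = c powi r * c"
    using a_nz \<rho>_nz \<sigma>_nz by (simp add: power_int_add)
  moreover have "rpoch q (a / \<rho>) (r + 1) = qfin q (a / \<rho> * q powi (r + 1)) k * rpoch q (a / \<rho>) n"
    "rpoch q (a / \<sigma>) (r + 1) = qfin q (a / \<sigma> * q powi (r + 1)) k * rpoch q (a / \<sigma>) n"
    using shift[of _ "r + 1" k] by (simp_all add: r)
  moreover have "rpoch q q (n - (r + 1)) = 1 / qfin q q k"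
    using q_nat(1)[of k] by (simp add: r)
  moreover have "(1 - a) * alpha_coeff n (r + 1) = qpoch q \<rho> (r + 1) * qpoch q \<sigma> (r + 1) * c powi (r + 1)
      * rpoch q (a / \<rho>) (r + 1) * rpoch q (a / \<sigma>) (r + 1) * rpoch q q (n - (r + 1)) * ((1 - a) * rpoch q a (n + r + 1))"
    by (simp add: alpha_coeff_def ac_simps)
  ultimately show ?thesis
    unfolding rpoch_a by (simp only: divide_inverse ac_simps mult_1_left mult_1_right)
qed

lemma alpha_coeff_above: "alpha_coeff n (n + 1) = 0"
  by (simp add: alpha_coeff_def rpoch_q_minus_1[OF norm_q q_nz])

text \<open>With \<open>x\<close>, \<open>y\<close>, \<open>A\<close> as chosen in the proof, the
  sum is \<open>D\<close> times the left-hand sum of \<open>contiguous_saalschutz\<close>. The two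
  terms of its value are, up to common factors, the coefficients at \<open>r\<close> and at
  \<open>r + 1\<close>.\<close>

lemma lattice_kernel:
  assumes r: "n = r + int m"
  shows "(\<Sum>j=r..n. lattice_weight q a \<rho> \<sigma> n j * (rpoch q q (j - r) * rpoch q (a * q) (j + r)))
    = (1 - a) * q powi r / (1 - a * q powi (2 * r)) * (alpha_coeff n r - alpha_coeff n (r + 1))"
proof -
  define x y A where "x = \<rho> * q powi r" and "y = \<sigma> * q powi r" and "A = a * q powi (2 * r)"
  define D where "D = qpoch q \<rho> r * qpoch q \<sigma> r * (c * q) powi r * rpoch q (a / \<rho>) n * rpoch q (a / \<sigma>) n
     * rpoch q (a * q) (n + r)"
  have c_nz: "c \<noteq> 0" using a_nz \<rho>_nz \<sigma>_nz by simp
  have A: "A = c * x * y"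
    using \<rho>_nz \<sigma>_nz by (simp add: A_def x_def y_def q_powi_double power2_eq_square)
  have cx: "a / \<sigma> * q powi r = c * x" and cy: "a / \<rho> * q powi r = c * y"
    using \<rho>_nz \<sigma>_nz by (simp_all add: x_def y_def)
  define T where "T i = qfin q x i * qfin q y i * (c * q) ^ i / qfin q q i
            * (qfin q c (m - i) / qfin q q (m - i)) * qfin q (A * q * q ^ i) (m - i)" for i
  have T: "lattice_weight q a \<rho> \<sigma> n (r + int i) * (rpoch q q (int i) * rpoch q (a * q) (2 * r + int i)) = D * T i"
    if "i \<le> m" for i
  proof -
    have "n - (r + int i) = int (m - i)" using that by (simp add: r)
    then have e: "qpoch q c (n - (r + int i)) = qfin q c (m - i)"
      "rpoch q q (n - (r + int i)) = 1 / qfin q q (m - i)"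
      by (simp_all only: qpoch_of_nat[OF norm_q q_nz inf_c] q_nat(1))
    \<comment> \<open>Advancing by \<open>m - i\<close> reaches the index
      \<open>2 * r + m = n + r\<close>, which does not depend on \<open>i\<close>, so the factor can
      go into \<open>D\<close>.\<close>
    have "rpoch q (a * q) (2 * r + int i) = qfin q (A * q * q ^ i) (m - i) * rpoch q (a * q) (n + r)"
      using shift[of "a * q" "2 * r + int i" "m - i"] that q_nz
      by (simp add: r A_def power_int_add ac_simps)
    moreover have "(c * q) powi (r + int i) = (c * q) powi r * (c * q) ^ i"
      using c_nz q_nz by (subst power_int_add) auto
    moreover have "qpoch q \<rho> (r + int i) = qpoch q \<rho> r * qfin q x i"
       "qpoch q \<sigma> (r + int i) = qpoch q \<sigma> r * qfin q y i"
      by (simp_all add: qpoch_shift[OF norm_q q_nz] inf_\<rho> inf_\<sigma> x_def y_def)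
    ultimately show ?thesis
      unfolding weight_eq e q_nat(1) D_def T_def
      by (simp only: divide_inverse ac_simps mult_1_left mult_1_right)
  qed
  have T': "D * T (nat (j - r)) = lattice_weight q a \<rho> \<sigma> n j * (rpoch q q (j - r) * rpoch q (a * q) (j + r))"
    if "r \<le> j" "j \<le> n" for j
  proof -
    have "r + int (nat (j - r)) = j" "int (nat (j - r)) = j - r" "2 * r + int (nat (j - r)) = j + r" "nat (j - r) \<le> m"
      using that by (simp_all add: r)
    then show ?thesis using T[of "nat (j - r)"] by (simp only:)
  qed
  have "(\<Sum>j=r..n. lattice_weight q a \<rho> \<sigma> n j * (rpoch q q (j - r) * rpoch q (a * q) (j + r)))
     = (\<Sum>i\<le>m. D * T i)"
    by (rule sum.reindex_bij_witness[where i = "\<lambda>i. r + int i" and j = "\<lambda>j. nat (j - r)"])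
       (use T' in \<open>auto simp: r\<close>)
  also have "\<dots> = D * sum T {..m}"
    by (simp add: sum_distrib_left)
  finally have L: "(\<Sum>j=r..n. lattice_weight q a \<rho> \<sigma> n j * (rpoch q q (j - r) * rpoch q (a * q) (j + r)))
     = D * sum T {..m}" .
  have B1: "(1 - a) * q powi r * alpha_coeff n r
      = D * (qfin q (c * x) m * qfin q (c * y) m * (1 - A * q ^ m) / qfin q q m)"
  proof -
    have "rpoch q (a / \<rho>) r = qfin q (c * y) m * rpoch q (a / \<rho>) n"
      "rpoch q (a / \<sigma>) r = qfin q (c * x) m * rpoch q (a / \<sigma>) n"
      using shift[of _ r m] by (simp_all only: r cx cy)
    moreover have "rpoch q q (n - r) = 1 / qfin q q m"
      using q_nat(1)[of m] by (simp add: r)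
    moreover have "(1 - a) * rpoch q a (n + r) = (1 - A * q ^ m) * rpoch q (a * q) (n + r)"
      using rpoch_step[OF norm_q q_nz, of a "n + r"] q_nz rpoch_a[of "n + r"]
      by (simp add: r A_def power_int_add q_powi_double power2_eq_square ac_simps)
    moreover have "(1 - a) * q powi r * alpha_coeff n r = qpoch q \<rho> r * qpoch q \<sigma> r * (c * q) powi r * rpoch q (a / \<rho>) r * rpoch q (a / \<sigma>) r
       * rpoch q q (n - r) * ((1 - a) * rpoch q a (n + r))"
      unfolding alpha_coeff_def power_int_mult_distrib by (simp only: ac_simps)
    ultimately show ?thesis
      unfolding D_def by (simp only: divide_inverse ac_simps mult_1_left mult_1_right)
  qed
  \<comment> \<open>For \<open>m = 0\<close> both sides vanish: here \<open>r = n\<close>, and the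
    coefficient at \<open>n + 1\<close> is zero.\<close>
  have B2: "(1 - a) * q powi r * alpha_coeff n (r + 1)
      = D * (if m = 0 then 0 else c * (1 - x) * (1 - y) * qfin q (c * x * q) (m - 1) * qfin q (c * y * q) (m - 1)
           / qfin q q (m - 1))"
  proof (cases m)
    case 0
    then show ?thesis using alpha_coeff_above[of n] by (simp add: r)
  next
    case (Suc k)
    then have n: "n = r + 1 + int k" by (simp add: r)
    have "(1 - a) * q powi r * alpha_coeff n (r + 1) = q powi r * ((1 - a) * alpha_coeff n (r + 1))" by simp
    moreover have "a / \<rho> * q powi (r + 1) = c * y * q" "a / \<sigma> * q powi (r + 1) = c * x * q"
      using q_nz unfolding cx[symmetric] cy[symmetric] by (simp_all add: power_int_add)
    ultimately show ?thesis
      unfolding alpha_coeff_Suc[OF n] D_def x_def[symmetric] y_def[symmetric] power_int_mult_distrib using Suc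
      by simp
  qed
  have "1 - A \<noteq> 0" unfolding A_def by (rule aq_nz)
  have "(1 - A) * (D * sum T {..m}) = D * ((1 - A) * sum T {..m})" by simp
  also have "\<dots> = (1 - a) * q powi r * alpha_coeff n r - (1 - a) * q powi r * alpha_coeff n (r + 1)"
    unfolding B1 B2 T_def contiguous_saalschutz[OF q_pow A] by (simp only: right_diff_distrib)
  finally have "D * sum T {..m} = (1 - a) * q powi r / (1 - A) * (alpha_coeff n r - alpha_coeff n (r + 1))"
    using \<open>1 - A \<noteq> 0\<close> by (simp add: field_simps)
  then show ?thesis unfolding L A_def .
qed

section \<open>The boundary term at minus infinity\<close>

text \<open>From \<open>k\<close> to \<open>Suc k\<close> each numerator product gains one factor of
  order \<open>q^(-k)\<close>; the denominator gains two of order \<open>q^(-2k)\<close> and loses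
  one of order \<open>q^(-k)\<close>. The ratio is therefore of order \<open>q^k\<close>.\<close>

lemma diagonal_ratio_tendsto_0:
  "(\<lambda>k. qfin q (u * q powi (n - int k)) k * qfin q (v * q powi (n - int k)) k
        / qfin q (a * q powi (2 * n - 2 * int k - 1)) (Suc k)) \<longlonglongrightarrow> 0"
    (is "?Y \<longlonglongrightarrow> 0")
proof (rule tendsto_0_if_ratio_tendsto_0)
  define P P1 P2 P3 where "P = q powi (n - 1)" and "P1 = q powi (2 * n - 1)" 
    and "P2 = q powi (2 * n - 3)" and "P3 = q powi (2 * n - 2)"
  define s where "s k = q ^ k" for k
  have P: "P \<noteq> 0" "P1 \<noteq> 0" "P2 \<noteq> 0" "P3 \<noteq> 0" using q_nz by (simp_all add: P_def P1_def P2_def P3_def)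
  have s: "s \<longlonglongrightarrow> 0" unfolding s_def by (rule LIMSEQ_power_zero[OF norm_q])
  have s_nz: "s k \<noteq> 0" for k using q_nz by (simp add: s_def)
  define R where "R k = (1 - u * (P / s k)) * (1 - v * (P / s k)) * (1 - a * (P1 / s k))
      / ((1 - a * (P2 / (s k)\<^sup>2)) * (1 - a * (P3 / (s k)\<^sup>2)))" for k
  have "R = (\<lambda>k. (s k - u * P) * (s k - v * P) * (s k - a * P1) * s k
      / (((s k)\<^sup>2 - a * P2) * ((s k)\<^sup>2 - a * P3)))"
  proof
    fix k
    have "1 - u * (P / s k) = (s k - u * P) / s k" "1 - v * (P / s k) = (s k - v * P) / s k"
      "1 - a * (P1 / s k) = (s k - a * P1) / s k"
      "1 - a * (P2 / (s k)\<^sup>2) = ((s k)\<^sup>2 - a * P2) / (s k)\<^sup>2"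
      "1 - a * (P3 / (s k)\<^sup>2) = ((s k)\<^sup>2 - a * P3) / (s k)\<^sup>2"
      using s_nz[of k] by (simp_all add: field_simps)
    then show "R k = (s k - u * P) * (s k - v * P) * (s k - a * P1) * s k
      / (((s k)\<^sup>2 - a * P2) * ((s k)\<^sup>2 - a * P3))" unfolding R_def using s_nz[of k] 
      by (simp add: power2_eq_square)
  qed
  moreover have "(\<lambda>k. (s k - u * P) * (s k - v * P) * (s k - a * P1) * s k
      / (((s k)\<^sup>2 - a * P2) * ((s k)\<^sup>2 - a * P3)))
     \<longlonglongrightarrow> (0 - u * P) * (0 - v * P) * (0 - a * P1) * 0 / ((0\<^sup>2 - a * P2) * (0\<^sup>2 - a * P3))"
    by (intro tendsto_intros s) (use P a_nz in auto)
  ultimately show "R \<longlonglongrightarrow> 0" by simp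
  have "(\<lambda>k. s k - a * P1) \<longlonglongrightarrow> 0 - a * P1" by (intro tendsto_intros s)
  \<comment> \<open>The factor that the denominator loses has to be cancelled, and it is known to be
    nonzero only for large \<open>k\<close>.\<close>
  then have "eventually (\<lambda>k. s k - a * P1 \<noteq> 0) sequentially"
    by (rule tendsto_imp_eventually_ne) (use P a_nz in auto)
  then show "\<forall>\<^sub>F k in sequentially. ?Y (Suc k) = ?Y k * R k"
  proof eventually_elim
    case (elim k)
    then have nz: "1 - a * (P1 / s k) \<noteq> 0" using s_nz[of k] by (simp add: field_simps)
    have e: "q powi (n - int (Suc k)) = P / s k" "q powi (n - int k) = P / s k * q"
      using q_nz unfolding P_def s_def
      by (simp_all add: power_int_diff power_int_add)
    have e2: "q powi (2 * n - 2 * int (Suc k) - 1) = P2 / (s k)\<^sup>2"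
       "q powi (2 * n - 2 * int k - 1) = P2 / (s k)\<^sup>2 * q * q"
      and P3: "P3 = P2 * q" and P1: "P1 = P2 * q * q"
      using q_nz unfolding P1_def P2_def P3_def s_def power2_eq_square
      by (simp_all add: power_int_diff power_int_add q_powi_double power2_eq_square power3_eq_cube)
    have f1: "qfin q (w * (P / s k)) (Suc k) = (1 - w * (P / s k)) * qfin q (w * (P / s k * q)) k" for w
      by (simp add: qfin_Suc_left mult.assoc)
    have f2: "qfin q (a * (P2 / (s k)\<^sup>2)) (Suc (Suc k))
        = (1 - a * (P2 / (s k)\<^sup>2)) * (1 - a * (P3 / (s k)\<^sup>2)) * qfin q (a * (P2 / (s k)\<^sup>2 * q * q)) k"
      unfolding qfin_Suc_left P3 by (simp add: ac_simps)
    have f3: "qfin q (a * (P2 / (s k)\<^sup>2 * q * q)) (Suc k)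
        = qfin q (a * (P2 / (s k)\<^sup>2 * q * q)) k * (1 - a * (P1 / s k))"
      unfolding qfin_Suc P1 using s_nz[of k] by (simp add: s_def[symmetric] power2_eq_square)
    have cancel: "(p1 * G) * (p2 * H) / (D * F) = G * H / (F * w) * (p1 * p2 * w / D)" if "w \<noteq> 0"
      for p1 p2 G H D F w :: complex
      using that by (simp add: ac_simps)
    show ?case
      unfolding e e2 f1 f2 f3 R_def by (rule cancel[OF nz])
  qed
qed

text \<open>The boundary term of the summation by parts is compared with the diagonal \<open>j = r\<close> of the
  absolutely convergent double series; their quotient tends to 0 by the ratio test.\<close>
lemma boundary_tendsto_0:
  assumes "lattice_abs_convergent q a \<rho> \<sigma> \<alpha>"
  shows "(\<lambda>k. (1 - a) * alpha_coeff n (n - int k) * (q powi (n - 1 - int k) * \<alpha> (n - 1 - int k)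
            / (1 - a * q powi (2 * (n - 1 - int k))))) \<longlonglongrightarrow> 0"
    (is "?b \<longlonglongrightarrow> 0")
proof -
  define P where "P = q powi (n - 1)"
  define s where "s k = q ^ k" for k
  have P: "P \<noteq> 0" using q_nz by (simp add: P_def)
  have s: "s \<longlonglongrightarrow> 0" unfolding s_def by (rule LIMSEQ_power_zero[OF norm_q])
  have s_nz: "s k \<noteq> 0" for k using q_nz by (simp add: s_def)
  define d where "d k = lattice_weight q a \<rho> \<sigma> n (n - int k)
     * (\<alpha> (n - int k) / (qpoch q q ((n - int k) - (n - int k)) * qpoch q (a * q) ((n - int k) + (n - int k))))" for k
  have "d \<longlonglongrightarrow> 0"
    unfolding d_def
    by (rule triangular_series_diagonal_tendsto_0[where f = "\<lambda>j r. lattice_weight q a \<rho> \<sigma> n j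
              * (\<alpha> r / (qpoch q q (j - r) * qpoch q (a * q) (j + r)))"])
       (use assms in \<open>simp add: lattice_abs_convergent_def\<close>)
  \<comment> \<open>The boundary term contains \<open>\<alpha> (n - 1 - int k)\<close>, which sits
    at diagonal position \<open>Suc k\<close>.\<close>
  then have d: "(\<lambda>k. d (Suc k)) \<longlonglongrightarrow> 0" by (rule LIMSEQ_Suc)
  \<comment> \<open>\<open>X\<close>, \<open>Y\<close> and
    \<open>c * (1 - q * s k) / qfin q c (Suc k)\<close> are the factors of boundary term over
    diagonal term. Numerator and denominator of \<open>X\<close> both have order
    \<open>q^(-2k)\<close>, so \<open>X\<close> has a finite limit; \<open>Y\<close> is the part
    that tends to 0.\<close>
  define X where "X k = (1 - \<rho> * (P / s k)) * (1 - \<sigma> * (P / s k)) / (1 - a * (P\<^sup>2 / (s k)\<^sup>2))" for k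
  define Y where "Y k = qfin q (a / \<rho> * q powi (n - int k)) k * qfin q (a / \<sigma> * q powi (n - int k)) k
        / qfin q (a * q powi (2 * n - 2 * int k - 1)) (Suc k)" for k
  have "X k = (s k - \<rho> * P) * (s k - \<sigma> * P) / ((s k)\<^sup>2 - a * P\<^sup>2)" for k
  proof -
    have "1 - \<rho> * (P / s k) = (s k - \<rho> * P) / s k" "1 - \<sigma> * (P / s k) = (s k - \<sigma> * P) / s k"
      "1 - a * (P\<^sup>2 / (s k)\<^sup>2) = ((s k)\<^sup>2 - a * P\<^sup>2) / (s k)\<^sup>2"
      using s_nz[of k] by (simp_all add: field_simps)
    then show ?thesis unfolding X_def using s_nz[of k] 
      by (simp add: power2_eq_square)
  qed
  then have X': "X = (\<lambda>k. (s k - \<rho> * P) * (s k - \<sigma> * P) / ((s k)\<^sup>2 - a * P\<^sup>2))" by blast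
  have X: "X \<longlonglongrightarrow> (0 - \<rho> * P) * (0 - \<sigma> * P) / (0\<^sup>2 - a * P\<^sup>2)"
    unfolding X' by (intro tendsto_intros s) (use P a_nz in auto)
  have Y: "Y \<longlonglongrightarrow> 0" unfolding Y_def by (rule diagonal_ratio_tendsto_0)
  have C: "(\<lambda>k. qfin q c (Suc k)) \<longlonglongrightarrow> qpoch_inf q c"
    by (rule LIMSEQ_Suc[OF qfin_tendsto[OF norm_q]])
  have "(\<lambda>k. d (Suc k) * (X k * (c * (1 - q * s k) / qfin q c (Suc k))) * Y k)
      \<longlonglongrightarrow> 0 * ((0 - \<rho> * P) * (0 - \<sigma> * P) / (0\<^sup>2 - a * P\<^sup>2) * (c * (1 - q * 0) / qpoch_inf q c)) * 0"
    by (intro tendsto_intros s d X Y C inf_c)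
  then have lim: "(\<lambda>k. d (Suc k) * (X k * (c * (1 - q * s k) / qfin q c (Suc k))) * Y k) \<longlonglongrightarrow> 0"
    by simp
  define Q where "Q = q powi (2 * n - 1)"
  \<comment> \<open>This bound keeps the denominator \<open>Z\<close> of \<open>Y k\<close> away
    from 0: a vanishing factor with index \<open>i \<le> k\<close> would force
    \<open>a * Q = q ^ (k - i) * s k\<close>.\<close>
  have "eventually (\<lambda>k. norm (s k) < norm (a * Q)) sequentially"
    using s a_nz q_nz by (simp add: tendsto_iff dist_norm Q_def)
  then have ev: "\<forall>\<^sub>F k in sequentially. d (Suc k) * (X k * (c * (1 - q * s k) / qfin q c (Suc k))) * Y k = ?b k"
  proof eventually_elim
    case (elim k)
    define r where "r = n - 1 - int k"
    define Z where "Z = qfin q (a * q powi (2 * r + 1)) (Suc k)"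
    have n: "n = r + 1 + int k" by (simp add: r_def)
    have Z: "Z \<noteq> 0"
    proof
      assume "Z = 0"
      then obtain i where i: "i \<le> k" "a * q powi (2 * r + 1) * q ^ i = 1"
        by (auto simp: Z_def qfin_def less_Suc_eq_le simp del: prod.lessThan_Suc)
      have "2 * n - 1 = (2 * r + 1) + int i + int (k - i) + int k"
        using i(1) by (simp add: n)
      then have "a * Q = q ^ (k - i) * s k * (a * q powi (2 * r + 1) * q ^ i)"
        unfolding Q_def s_def using q_nz by (simp add: power_int_add)
      then have "norm (a * Q) = norm q ^ (k - i) * norm (s k)"
        using i(2) by (simp add: norm_mult norm_power)
      also have "\<dots> \<le> norm (s k)"
        using norm_q by (intro mult_left_le_one_le) (auto intro: power_le_one)
      finally show False using elim by simp
    qed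
    have qr: "q powi r = P / s k" "q powi (2 * r) = P\<^sup>2 / (s k)\<^sup>2"
      using q_nz unfolding r_def P_def s_def
      by (simp_all add: power_int_diff q_powi_double power_divide)
    have nk: "n - int k = r + 1" "n - int (Suc k) = r" "n - 1 - int k = r"
      "2 * n - 2 * int k - 1 = 2 * r + 1" "n - r = int (Suc k)"
      by (simp_all add: n)
    have nz: "qfin q q k \<noteq> 0" "1 - q * s k \<noteq> 0" "qfin q c (Suc k) \<noteq> 0" "1 - a * q powi (2 * r) \<noteq> 0"
      using qfin_q_nonzero[OF q_pow] q_pow[of k] rpoch_of_nat(2)[OF norm_q q_nz inf_c] aq_nz[of r]
      by (auto simp: s_def)
    \<comment> \<open>The diagonal has \<open>(a q)_(2r)\<close> and the boundary term
      \<open>(a q)_(n+r)\<close>; they differ by the \<open>n - r = Suc k\<close> factors collected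
      in \<open>Z\<close>.\<close>
    have rp: "rpoch q (a * q) (r + r) = Z * rpoch q (a * q) (n + r)"
      using shift[of "a * q" "r + r" "Suc k"] q_nz unfolding Z_def n
      by (simp add: power_int_add ac_simps)
    have wt: "lattice_weight q a \<rho> \<sigma> n r = qpoch q \<rho> r * qpoch q \<sigma> r * qfin q c (Suc k) * (c powi r * q powi r)
     * (1 / (qfin q q k * (1 - q * s k))) * rpoch q (a / \<rho>) n * rpoch q (a / \<sigma>) n"
      unfolding weight_eq nk qpoch_of_nat[OF norm_q q_nz inf_c] q_nat(1) power_int_mult_distrib
      by (simp add: qfin_Suc s_def)
    have dk: "d (Suc k) = lattice_weight q a \<rho> \<sigma> n r * (\<alpha> r * (Z * rpoch q (a * q) (n + r)))"
      unfolding d_def nk divide_mult_qpoch divide_qpoch rp[symmetric]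
      using rpoch_0[OF qpoch_inf_q_nonzero[OF norm_q]] by simp
    have Xk: "X k = (1 - \<rho> * q powi r) * (1 - \<sigma> * q powi r) / (1 - a * q powi (2 * r))"
      unfolding X_def qr ..
    have Yk: "Y k = qfin q (a / \<rho> * q powi (r + 1)) k * qfin q (a / \<sigma> * q powi (r + 1)) k / Z"
      unfolding Y_def nk Z_def ..
    have cancel: "(x1 * x2 * C * (e * p) * (1 / (F * h)) * u * v) * (z * (t * w)) * (p1 * p2 / D * (c' * h / C)) * (G * H / t)
        = x1 * x2 * e * u * v * w * (c' * p1 * p2 * G * H / F) * (p * z / D)"
      if "F \<noteq> 0" "h \<noteq> 0" "C \<noteq> 0" "D \<noteq> 0" "t \<noteq> 0"
      for x1 x2 C e p F h u v z t w p1 p2 D c' G H :: complex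
      using that by (simp add: field_simps)
    show ?case
      unfolding nk alpha_coeff_Suc[OF n] dk wt Xk Yk by (rule cancel) (use nz Z in auto)
  qed
  show ?thesis
    using lim by (rule Lim_transform_eventually) (rule ev)
qed

section \<open>Interchange of summations and summation by parts\<close>

lemma bilateral_bailey_pair_lattice:
  assumes pair: "bilateral_bailey_pair q a \<alpha> \<beta>"
    and abs: "lattice_abs_convergent q a \<rho> \<sigma> \<alpha>"
  shows "bilateral_bailey_pair q (a / q) (lattice_alpha q a \<rho> \<sigma> \<alpha>) (lattice_beta q a \<rho> \<sigma> \<beta>)"
  unfolding bilateral_bailey_pair_def
proof
  fix n
  define f where "f j r = lattice_weight q a \<rho> \<sigma> n j
              * (\<alpha> r / (qpoch q q (j - r) * qpoch q (a * q) (j + r)))" for j r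
  define g where "g r = q powi r * \<alpha> r / (1 - a * q powi (2 * r))" for r
  have "sums_upto (\<lambda>r. \<Sum>j=r..n. f j r) n (sum_upto (\<lambda>j. lattice_weight q a \<rho> \<sigma> n j * \<beta> j) n)"
  proof (rule triangular_series_swap)
    show "(\<lambda>(j, r). norm (f j r)) summable_on (SIGMA j:{..n}. {..j})"
      using abs by (simp add: lattice_abs_convergent_def f_def)
    show "sums_upto (f j) j (lattice_weight q a \<rho> \<sigma> n j * \<beta> j)" for j
    proof -
      have "sums_upto (\<lambda>r. \<alpha> r / (qpoch q q (j - r) * qpoch q (a * q) (j + r))) j (\<beta> j)"
        using pair unfolding bilateral_bailey_pair_def by (rule spec)
      then show ?thesis unfolding sums_upto_def f_def by (rule sums_mult)
    qed
  qed
  then have "(\<lambda>i. \<Sum>j=n - int i..n. f j (n - int i)) sums lattice_beta q a \<rho> \<sigma> \<beta> n"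
    by (simp add: sums_upto_def lattice_beta_def)
  moreover have "(\<Sum>j=n - int i..n. f j (n - int i))
      = (1 - a) * (alpha_coeff n (n - int i) - alpha_coeff n (n - int i + 1)) * g (n - int i)" for i
  proof -
    let ?r = "n - int i"
    have "(\<Sum>j=?r..n. f j ?r) = (\<Sum>j=?r..n. lattice_weight q a \<rho> \<sigma> n j
         * (rpoch q q (j - ?r) * rpoch q (a * q) (j + ?r))) * \<alpha> ?r"
      unfolding f_def divide_mult_qpoch divide_qpoch sum_distrib_right by (simp add: ac_simps)
    also have "\<dots> = (1 - a) * q powi ?r / (1 - a * q powi (2 * ?r)) * (alpha_coeff n ?r - alpha_coeff n (?r + 1)) * \<alpha> ?r"
      by (subst lattice_kernel[of n ?r i]) simp_all
    also have "\<dots> = (1 - a) * (alpha_coeff n ?r - alpha_coeff n (?r + 1)) * g ?r"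
      by (simp add: g_def ac_simps)
    finally show ?thesis .
  qed
  ultimately have s1: "(\<lambda>i. (1 - a) * (alpha_coeff n (n - int i) - alpha_coeff n (n - int i + 1)) * g (n - int i))
      sums lattice_beta q a \<rho> \<sigma> \<beta> n" by simp
  \<comment> \<open>The difference \<open>b i - b (Suc i)\<close> trades a difference of
    coefficients for a difference of values of \<open>g\<close>. Its series has sum 0, since
    \<open>b 0\<close> contains the coefficient at \<open>n + 1\<close> and \<open>b\<close> tends
    to 0.\<close>
  define b where "b i = (1 - a) * alpha_coeff n (n - int i + 1) * g (n - int i)" for i
  have "(\<lambda>k. (1 - a) * alpha_coeff n (n - int k) * g (n - 1 - int k)) \<longlonglongrightarrow> 0"
    unfolding g_def by (rule boundary_tendsto_0[OF abs])
  then have "(\<lambda>k. b (Suc k)) \<longlonglongrightarrow> 0"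
    by (simp add: b_def algebra_simps)
  then have "b \<longlonglongrightarrow> 0" by (rule LIMSEQ_imp_Suc)
  then have "(\<lambda>i. b i - b (Suc i)) sums (b 0 - 0)" by (rule telescope_sums')
  moreover have "b 0 = 0" using alpha_coeff_above[of n] by (simp add: b_def)
  ultimately have "(\<lambda>i. (1 - a) * (alpha_coeff n (n - int i) - alpha_coeff n (n - int i + 1)) * g (n - int i) + (b i - b (Suc i)))
      sums (lattice_beta q a \<rho> \<sigma> \<beta> n + 0)"
    by (intro sums_add s1) simp
  \<comment> \<open>With \<open>r = n - int i\<close> the two terms in
    \<open>alpha_coeff n (r + 1) * g r\<close> cancel, leaving
    \<open>(1 - a) * alpha_coeff n r * (g r - g (r - 1))\<close>.\<close>
  moreover have "(1 - a) * (alpha_coeff n (n - int i) - alpha_coeff n (n - int i + 1)) * g (n - int i) + (b i - b (Suc i))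
      = lattice_alpha q a \<rho> \<sigma> \<alpha> (n - int i) / (qpoch q q (n - (n - int i)) * qpoch q (a / q * q) (n + (n - int i)))"
    for i
  proof -
    define r where "r = n - int i"
    have b: "b i = (1 - a) * alpha_coeff n (r + 1) * g r" "b (Suc i) = (1 - a) * alpha_coeff n r * g (r - 1)"
      by (simp_all add: b_def r_def algebra_simps)
    have aq: "a / q * q = a" using q_nz by simp
    have la: "lattice_alpha q a \<rho> \<sigma> \<alpha> r = qpoch q \<rho> r * qpoch q \<sigma> r * c powi r * rpoch q (a / \<rho>) r * rpoch q (a / \<sigma>) r
        * (1 - a) * (g r - g (r - 1))"
      unfolding lattice_alpha_def divide_mult_qpoch divide_qpoch g_def by (simp add: right_diff_distrib)
    show ?thesis
      unfolding r_def[symmetric] b aq divide_mult_qpoch divide_qpoch la alpha_coeff_def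
      by (simp add: algebra_simps)
  qed
  ultimately show "sums_upto (\<lambda>j. lattice_alpha q a \<rho> \<sigma> \<alpha> j / (qpoch q q (n - j) * qpoch q (a / q * q) (n + j)))
      n (lattice_beta q a \<rho> \<sigma> \<beta> n)"
    by (simp add: sums_upto_def)
qed

end

theorem theorem1p11:
  fixes a q \<rho> \<sigma> :: complex and \<alpha> \<beta> :: "int \<Rightarrow> complex"
  assumes "norm q < 1"
    and "q \<noteq> 0" "a \<noteq> 0" "\<rho> \<noteq> 0" "\<sigma> \<noteq> 0"
    and "qpoch_inf q a \<noteq> 0"
    and "\<And>n::int. 1 - a * q powi (2 * n) \<noteq> 0"
    and "\<And>n::int. qpoch_inf q (\<rho> * q powi n) \<noteq> 0"
    and "\<And>n::int. qpoch_inf q (\<sigma> * q powi n) \<noteq> 0"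
    and "qpoch_inf q (a / \<rho>) \<noteq> 0" "qpoch_inf q (a / \<sigma>) \<noteq> 0"
    and "qpoch_inf q (a / (\<rho> * \<sigma>)) \<noteq> 0"
    and "bilateral_bailey_pair q a \<alpha> \<beta>"
    and "lattice_abs_convergent q a \<rho> \<sigma> \<alpha>"
  shows "bilateral_bailey_pair q (a / q)
           (lattice_alpha q a \<rho> \<sigma> \<alpha>) (lattice_beta q a \<rho> \<sigma> \<beta>)"
proof -
  interpret bailey_lattice a q \<rho> \<sigma>
    by unfold_locales (rule assms)+
  show ?thesis
    using assms(13,14) by (rule bilateral_bailey_pair_lattice)
qed

end
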